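(* Let $1\le k\le n$. The number of frustrated parking functions of length $n$ with exactly $k$ lucky cars is the second order Eulerian number $E_2(n,k)$. This is also the number of frustrated parking functions of length $n$ with exactly $k$ lucky spots.
   Context: Let $n\ge 1$ and $[n]=\{1,2,\dots,n\}$. There are $n$ cars and $n$ parking spots numbered $1,\dots,n$, all initially empty. Given a preference sequence $(a_1,\dots,a_n)\in[n]^n$, cars $1,2,\dots,n$ enter in this order. If spot $a_i$ is unoccupied when car $i$ enters, car $i$ parks in spot $a_i$. Otherwise car $i$ parks in the largest-numbered unoccupied spot greater than $a_i$, if such a spot exists; if none exists, car $i$ cannot park. The sequence $(a_1,\dots,a_n)$ is a frustrated parking function of length $n$ if all $n$ cars can park under this rule. For a frustrated parking function, car $j$ is lucky if it parks in its preferred spot $a_j$, and unlucky otherwise; a spot is lucky if the car that parks in it is lucky, and unlucky otherwise. The second order Eulerian numbers $E_2(n,k)$, with the indexing $1\le k\le n$ (OEIS A008517), are given by $E_2(1,1)=1$, $E_2(n,k)=0$ for $k<1$ or $k>n$, and $E_2(n,k)=k\,E_2(n-1,k)+(2n-k)\,E_2(n-1,k-1)$ for $n\ge 2$, $1\le k\le n$. Equivalently, $E_2(n,k)$ is the number of Stirling permutations of length $2n$ (words using each element of $[n]$ exactly twice in which every entry between the two copies of $i$ is larger than $i$) with $k$ descents, where the final position is counted as a descent. *)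

theory Defs
  imports Main
begin

text \<open>Spots are the numbers \<open>1, \<dots>, n\<close>; \<open>occ\<close> is the set of spots occupied when a car with
  preference \<open>a\<close> enters. \<open>None\<close> means that the car cannot park.\<close>

definition parking_spot :: "nat \<Rightarrow> nat set \<Rightarrow> nat \<Rightarrow> nat option" where
  "parking_spot n occ a =
     (if a \<notin> occ then Some a
      else if {s \<in> {1..n}. a < s \<and> s \<notin> occ} \<noteq> {}
           then Some (Max {s \<in> {1..n}. a < s \<and> s \<notin> occ})
           else None)"

text \<open>A car that cannot park leaves the set of occupied spots unchanged.\<close>

fun park_from :: "nat \<Rightarrow> nat set \<Rightarrow> nat list \<Rightarrow> nat option list" where
  "park_from n occ [] = []"
| "park_from n occ (a # as) =
     parking_spot n occ a # park_from n (occ \<union> set_option (parking_spot n occ a)) as"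

definition park :: "nat \<Rightarrow> nat list \<Rightarrow> nat option list" where
  "park n as = park_from n {} as"

definition frustrated_parking_function :: "nat \<Rightarrow> nat list \<Rightarrow> bool" where
  "frustrated_parking_function n as \<longleftrightarrow>
     length as = n \<and> set as \<subseteq> {1..n} \<and> None \<notin> set (park n as)"

text \<open>Cars are numbered from \<open>1\<close>, whereas list positions start at \<open>0\<close>.\<close>

definition lucky_cars :: "nat \<Rightarrow> nat list \<Rightarrow> nat set" where
  "lucky_cars n as = {j \<in> {1..n}. park n as ! (j - 1) = Some (as ! (j - 1))}"

definition lucky_spots :: "nat \<Rightarrow> nat list \<Rightarrow> nat set" where
  "lucky_spots n as = {s \<in> {1..n}. \<exists>j \<in> lucky_cars n as. park n as ! (j - 1) = Some s}"

text \<open>Second order Eulerian numbers, indexed by \<open>1 \<le> k \<le> n\<close>. The subtraction \<open>2 * n - k\<close> is only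
  reached for \<open>k \<le> n\<close>, so it does not truncate.\<close>

fun eulerian2 :: "nat \<Rightarrow> nat \<Rightarrow> nat" where
  "eulerian2 n k =
     (if k < 1 \<or> k > n then 0
      else if n = 1 then 1
      else k * eulerian2 (n - 1) k + (2 * n - k) * eulerian2 (n - 1) (k - 1))"

declare eulerian2.simps [simp del]

end

theory Submission
  imports Defs
begin

text \<open>
  An unlucky car always takes the largest spot of the whole street that is still free: if the
  largest free spot lies above the preference, it is the one chosen, and otherwise the car fails.
  This makes it easy to undo the last car. It parks in the only spot \<open>s\<close> that is left, with any
  preference \<open>a \<le> s\<close>, and it is lucky iff \<open>a = s\<close>. Delete this car and the spot \<open>s\<close>, and close the
  gap. The earlier cars then form a frustrated parking function \<open>cs\<close> of length \<open>n\<close> in which every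
  unlucky car parks at or above \<open>s\<close>, since while \<open>s\<close> is free no unlucky car can park below it.
  Conversely, let \<open>u\<close> be the smallest unlucky spot of \<open>cs\<close>, or \<open>n + 1\<close> if there is none. Every
  choice of \<open>1 \<le> a \<le> s \<le> u\<close> can be attached to \<open>cs\<close> (\<open>attach_surj\<close>, \<open>attach_in_frustrated_pfs\<close>,
  \<open>attach_eqD\<close>). A lucky new car turns \<open>u\<close> into \<open>u + 1\<close>, an unlucky one turns it into \<open>s\<close>.

  Let \<open>H\<^sub>n(u, k)\<close> count the frustrated parking functions of length \<open>n\<close> with smallest unlucky spot
  \<open>u\<close> and \<open>k\<close> lucky cars, and let \<open>S\<^sub>n(u, k)\<close> be the sum of \<open>H\<^sub>n(x, k)\<close> over \<open>x \<ge> u\<close>. The above says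
  \<open>H\<^sub>n\<^sub>+\<^sub>1(u + 1, k) = u (H\<^sub>n(u, k - 1) + S\<^sub>n(u + 1, k))\<close>. Summed over \<open>u\<close>, this is not yet a
  recurrence for the totals \<open>S\<^sub>n(1, k)\<close>. The Eulerian recurrence has, however, the refinement
  \<open>S\<^sub>n\<^sub>+\<^sub>1(u + 1, k) = k S\<^sub>n(u + 1, k) + u S\<^sub>n(u, k - 1) + (2n + 2 - k - u) S\<^sub>n(u + 1, k - 1)\<close>
  for \<open>u \<ge> 1\<close>. Taking the difference of its instances at \<open>u\<close> and \<open>u + 1\<close> and cancelling shows that
  it amounts to the linear relation
  \<open>v S\<^sub>n(v + 1, k) = k H\<^sub>n(v + 1, k) + (2n + 1 - k - v) H\<^sub>n(v + 1, k - 1)\<close>,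
  and this relation passes from \<open>n\<close> to \<open>n + 1\<close> by way of the refinement (\<open>count_from_Suc\<close>,
  \<open>count_balance\<close>). As nobody parks unluckily in spot \<open>1\<close>, the case \<open>u = 1\<close> is the recurrence
  of the second order Eulerian numbers.

  For the lucky spots, sending a lucky car to its spot is a bijection onto the lucky spots.
\<close>

section \<open>Parking one car at a time\<close>

lemma park_from_append:
  "park_from n occ (as @ bs) =
     park_from n occ as @ park_from n (occ \<union> {p. Some p \<in> set (park_from n occ as)}) bs"
proof (induction as arbitrary: occ)
  case (Cons a as)
  have "occ \<union> set_option (parking_spot n occ a)
          \<union> {p. Some p \<in> set (park_from n (occ \<union> set_option (parking_spot n occ a)) as)}
        = occ \<union> {p. Some p \<in> set (park_from n occ (a # as))}"
    by (cases "parking_spot n occ a") auto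
  then show ?case
    by (simp only: append_Cons park_from.simps Cons.IH)
qed simp

lemma length_park_from [simp]: "length (park_from n occ as) = length as"
  by (induction as arbitrary: occ) auto

lemma length_park [simp]: "length (park n as) = length as"
  by (simp add: park_def)

lemma parking_spot_SomeD:
  assumes "parking_spot n occ a = Some p"
  shows "p \<notin> occ" "a \<in> {1..n} \<Longrightarrow> p \<in> {1..n}"
proof -
  let ?F = "{s \<in> {1..n}. a < s \<and> s \<notin> occ}"
  have "finite ?F" by simp
  then have "?F \<noteq> {} \<Longrightarrow> Max ?F \<in> ?F"
    by (rule Max_in)
  then have "p \<notin> occ \<and> (p = a \<or> p \<in> {1..n})"
    using assms unfolding parking_spot_def by (cases "?F = {}") (auto split: if_splits simp del: atLeastAtMost_iff)
  then show "p \<notin> occ" "a \<in> {1..n} \<Longrightarrow> p \<in> {1..n}"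
    by auto
qed

lemma park_from_spot_free: "Some p \<in> set (park_from n occ as) \<Longrightarrow> p \<notin> occ"
  by (induction as arbitrary: occ) (auto dest: parking_spot_SomeD(1)[OF sym])

lemma park_from_spot_in_range:
  "set as \<subseteq> {1..n} \<Longrightarrow> Some p \<in> set (park_from n occ as) \<Longrightarrow> p \<in> {1..n}"
proof (induction as arbitrary: occ)
  case (Cons a as)
  then show ?case
    using parking_spot_SomeD(2)[of n occ a p] by auto
qed simp

lemma distinct_park_from: "None \<notin> set (park_from n occ as) \<Longrightarrow> distinct (park_from n occ as)"
proof (induction as arbitrary: occ)
  case (Cons a as)
  then obtain p where p: "parking_spot n occ a = Some p"
    by (cases "parking_spot n occ a") auto
  then show ?case
    using Cons by (auto dest: park_from_spot_free)
qed simp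

text \<open>A spot that stays free is nobody's preference: the first car to prefer it would take it.
  So no preference is lost when a free spot is deleted from the street.\<close>

lemma preference_gets_occupied:
  "a \<in> set as \<Longrightarrow> a \<in> occ \<or> Some a \<in> set (park_from n occ as)"
proof (induction as arbitrary: occ)
  case (Cons b as)
  show ?case
  proof (cases "a = b")
    case True
    then show ?thesis by (auto simp: parking_spot_def)
  next
    case False
    then show ?thesis
      using Cons.IH[of "occ \<union> set_option (parking_spot n occ b)"] Cons.prems
      by (cases "parking_spot n occ b") auto
  qed
qed simp

lemma card_park_spots:
  assumes "None \<notin> set (park n as)"
  shows "card {p. Some p \<in> set (park n as)} = length as"
proof -
  have "set (park n as) = Some ` {p. Some p \<in> set (park n as)}"
    using assms by (auto simp: image_iff) (metis option.exhaust)
  then have "card (set (park n as)) = card {p. Some p \<in> set (park n as)}"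
    by (metis card_image inj_Some)
  then show ?thesis
    using distinct_park_from assms distinct_card[of "park n as"] by (simp add: park_def)
qed

section \<open>Inserting a spot that stays empty\<close>

text \<open>The renumbering of the old spots when a new spot \<open>s\<close> is inserted into the street.\<close>

definition shift :: "nat \<Rightarrow> nat \<Rightarrow> nat" where
  "shift s x = (if x < s then x else Suc x)"

lemma shift_eq_iff [simp]: "shift s x = shift s y \<longleftrightarrow> x = y"
  by (auto simp: shift_def)

lemma shift_less_iff [simp]: "shift s x < shift s y \<longleftrightarrow> x < y"
  by (auto simp: shift_def)

lemma shift_neq [simp]: "shift s x \<noteq> s" "s \<noteq> shift s x"
  by (auto simp: shift_def)

lemma shift_in_range: "x \<in> {1..n} \<Longrightarrow> shift s x \<in> {1..Suc n}"
  by (auto simp: shift_def)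

lemma shift_image:
  assumes "s \<in> {1..Suc n}"
  shows "shift s ` {1..n} = {1..Suc n} - {s}"
proof
  show "{1..Suc n} - {s} \<subseteq> shift s ` {1..n}"
  proof
    fix x assume "x \<in> {1..Suc n} - {s}"
    then have "x = shift s (if x < s then x else x - 1)" "(if x < s then x else x - 1) \<in> {1..n}"
      using assms by (auto simp: shift_def)
    then show "x \<in> shift s ` {1..n}" by blast
  qed
qed (auto simp: shift_def)

text \<open>The new spot \<open>s\<close> is free, so it attracts every unlucky car that would otherwise park below
  it, and every failing car with preference below it. All other cars behave as before.\<close>

lemma parking_spot_shift:
  assumes "s \<in> {1..Suc n}" "occ \<subseteq> {1..n}" "a \<in> {1..n}"
  shows "parking_spot (Suc n) (shift s ` occ) (shift s a) =
    (case parking_spot n occ a of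
       Some p \<Rightarrow> if p = a \<or> s \<le> p then Some (shift s p) else Some s
     | None \<Rightarrow> if shift s a < s then Some s else None)"
proof (cases "a \<in> occ")
  case False
  then show ?thesis by (auto simp: parking_spot_def)
next
  case True
  define F where "F = {x \<in> {1..n}. a < x \<and> x \<notin> occ}"
  define F' where "F' = {x \<in> {1..Suc n}. shift s a < x \<and> x \<notin> shift s ` occ}"
  have fin: "finite F" "finite F'" by (auto simp: F_def F'_def)
  have "{1..Suc n} = insert s (shift s ` {1..n})"
    using shift_image[OF assms(1)] assms(1) by blast
  then have F': "F' = shift s ` F \<union> (if shift s a < s then {s} else {})"
    unfolding F'_def F_def by auto
  have L: "parking_spot n occ a = (if F \<noteq> {} then Some (Max F) else None)"
    using True unfolding parking_spot_def F_def by simp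
  have R: "parking_spot (Suc n) (shift s ` occ) (shift s a)
             = (if F' \<noteq> {} then Some (Max F') else None)"
    using True unfolding parking_spot_def F'_def by simp
  show ?thesis
  proof (cases "F = {}")
    case True
    then show ?thesis using L R F' by auto
  next
    case ne: False
    have max: "Max F \<in> F" "\<And>x. x \<in> F \<Longrightarrow> x \<le> Max F"
      using fin ne by auto
    then have "a < Max F" by (auto simp: F_def)
    show ?thesis
    proof (cases "s \<le> Max F")
      case True
      have "Max F' = shift s (Max F)"
        using fin max True by (intro Max_eqI) (auto simp: F' shift_def split: if_splits dest!: max(2))
      then show ?thesis using L R F' ne True by auto
    next
      case False
      have "Max F' = s"
        using fin max False \<open>a < Max F\<close>
        by (intro Max_eqI) (auto simp: F' shift_def split: if_splits dest!: max(2))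
      moreover have "F' \<noteq> {}" using ne F' by auto
      ultimately show ?thesis using L R ne False \<open>a < Max F\<close> by auto
    qed
  qed
qed

text \<open>The two streets stay in step as long as all cars park and nobody takes \<open>s\<close>. The first car
  that fails or takes \<open>s\<close> in the longer street is also the first one that fails or parks
  unluckily below \<open>s\<close> in the shorter street. This is why the equivalence holds although the runs are unrelated from there
  on. Both claims are proved together because the induction follows the common occupied set.\<close>

lemma park_from_shift:
  assumes s: "s \<in> {1..Suc n}"
    and "occ \<subseteq> {1..n}" "set as \<subseteq> {1..n}"
  defines "P \<equiv> park_from n occ as"
    and "P' \<equiv> park_from (Suc n) (shift s ` occ) (map (shift s) as)"
  shows "((None \<notin> set P' \<and> Some s \<notin> set P') \<longleftrightarrow>
      None \<notin> set P \<and> (\<forall>a p. (a, Some p) \<in> set (zip as P) \<longrightarrow> a \<noteq> p \<longrightarrow> s \<le> p)) \<and>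
    (None \<notin> set P' \<and> Some s \<notin> set P' \<longrightarrow> P' = map (map_option (shift s)) P)"
  using assms(2,3) unfolding P_def P'_def
proof (induction as arbitrary: occ)
  case Nil
  show ?case by simp
next
  case (Cons a as)
  define occ1 where "occ1 = occ \<union> set_option (parking_spot n occ a)"
  have step: "parking_spot (Suc n) (shift s ` occ) (shift s a) =
    (case parking_spot n occ a of
       Some p \<Rightarrow> if p = a \<or> s \<le> p then Some (shift s p) else Some s
     | None \<Rightarrow> if shift s a < s then Some s else None)"
    using Cons.prems by (intro parking_spot_shift s) auto
  show ?case
  proof (cases "\<exists>p. parking_spot n occ a = Some p \<and> (p = a \<or> s \<le> p)")
    case True
    then obtain p where p: "parking_spot n occ a = Some p" "p = a \<or> s \<le> p" by blast
    have st: "parking_spot (Suc n) (shift s ` occ) (shift s a) = Some (shift s p)"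
      using step p by auto
    have occ1: "occ \<union> {p} = occ1" "shift s ` occ \<union> {shift s p} = shift s ` occ1"
      using p by (auto simp: occ1_def)
    have "occ1 \<subseteq> {1..n}"
      using Cons.prems p parking_spot_SomeD(2)[of n occ a p] by (auto simp: occ1_def)
    then have IH: "((None \<notin> set (park_from (Suc n) (shift s ` occ1) (map (shift s) as)) \<and>
          Some s \<notin> set (park_from (Suc n) (shift s ` occ1) (map (shift s) as))) \<longleftrightarrow>
        None \<notin> set (park_from n occ1 as) \<and>
        (\<forall>a p. (a, Some p) \<in> set (zip as (park_from n occ1 as)) \<longrightarrow> a \<noteq> p \<longrightarrow> s \<le> p)) \<and>
      (None \<notin> set (park_from (Suc n) (shift s ` occ1) (map (shift s) as)) \<and>
        Some s \<notin> set (park_from (Suc n) (shift s ` occ1) (map (shift s) as)) \<longrightarrow>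
        park_from (Suc n) (shift s ` occ1) (map (shift s) as)
          = map (map_option (shift s)) (park_from n occ1 as))"
      using Cons.prems by (intro Cons.IH) auto
    have "park_from n occ (a # as) = Some p # park_from n occ1 as"
      by (simp add: p(1) occ1_def)
    moreover have "park_from (Suc n) (shift s ` occ) (map (shift s) (a # as))
        = Some (shift s p) # park_from (Suc n) (shift s ` occ1) (map (shift s) as)"
      using occ1(2) st by simp
    ultimately show ?thesis
      using IH p(2) by auto
  next
    case False
    then show ?thesis using step by (auto split: option.splits if_splits)
  qed
qed


section \<open>Removing the last car\<close>

definition frustrated_pfs :: "nat \<Rightarrow> nat list set" where
  "frustrated_pfs n = {as. frustrated_parking_function n as}"

definition unlucky_spots :: "nat \<Rightarrow> nat list \<Rightarrow> nat set" where
  "unlucky_spots n as = {p. \<exists>a. (a, Some p) \<in> set (zip as (park n as)) \<and> a \<noteq> p}"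

text \<open>The default \<open>Suc n\<close> lets a function without unlucky cars obey the same rules as any
  other: a new spot may then be inserted anywhere from \<open>1\<close> up to \<open>Suc n\<close>.\<close>

definition first_unlucky :: "nat \<Rightarrow> nat list \<Rightarrow> nat" where
  "first_unlucky n as = Min (insert (Suc n) (unlucky_spots n as))"

text \<open>The inverse of removing the last car: \<open>s\<close> is the spot in which it parks and \<open>a\<close> its
  preference.\<close>

definition attach :: "nat list \<times> nat \<times> nat \<Rightarrow> nat list" where
  "attach = (\<lambda>(cs, s, a). map (shift s) cs @ [a])"

lemma finite_frustrated_pfs [simp]: "finite (frustrated_pfs n)"
proof (rule finite_subset)
  show "frustrated_pfs n \<subseteq> {as. set as \<subseteq> {1..n} \<and> length as = n}"
    by (auto simp: frustrated_pfs_def frustrated_parking_function_def)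
qed (simp add: finite_lists_length_eq)

lemma finite_unlucky_spots [simp]: "finite (unlucky_spots n as)"
proof (rule finite_subset)
  show "unlucky_spots n as \<subseteq> the ` set (park n as)"
    by (force simp: unlucky_spots_def dest: set_zip_rightD)
qed simp

lemma unlucky_spots_range:
  "set as \<subseteq> {1..n} \<Longrightarrow> unlucky_spots n as \<subseteq> {1..n}"
  using park_from_spot_in_range[of as n _ "{}"]
  unfolding unlucky_spots_def park_def by (blast dest: set_zip_rightD)

lemma first_unlucky_range:
  assumes "as \<in> frustrated_pfs n"
  shows "first_unlucky n as \<in> {1..Suc n}"
proof -
  have "first_unlucky n as \<in> insert (Suc n) (unlucky_spots n as)"
    unfolding first_unlucky_def by (intro Min_in) auto
  then show ?thesis
    using unlucky_spots_range[of as n] assms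
    by (auto simp: frustrated_pfs_def frustrated_parking_function_def)
qed

lemma park_shift:
  assumes "s \<in> {1..Suc n}" "set cs \<subseteq> {1..n}"
  shows "None \<notin> set (park (Suc n) (map (shift s) cs)) \<and>
      Some s \<notin> set (park (Suc n) (map (shift s) cs)) \<longleftrightarrow>
      None \<notin> set (park n cs) \<and> s \<le> first_unlucky n cs"
    and "None \<notin> set (park n cs) \<Longrightarrow> s \<le> first_unlucky n cs \<Longrightarrow>
      park (Suc n) (map (shift s) cs) = map (map_option (shift s)) (park n cs)"
proof -
  have "s \<le> first_unlucky n cs \<longleftrightarrow>
      (\<forall>a p. (a, Some p) \<in> set (zip cs (park n cs)) \<longrightarrow> a \<noteq> p \<longrightarrow> s \<le> p)"
    using assms(1) Min_ge_iff[of "insert (Suc n) (unlucky_spots n cs)" s]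
    unfolding first_unlucky_def by simp (auto simp: unlucky_spots_def)
  then show "None \<notin> set (park (Suc n) (map (shift s) cs)) \<and>
      Some s \<notin> set (park (Suc n) (map (shift s) cs)) \<longleftrightarrow>
      None \<notin> set (park n cs) \<and> s \<le> first_unlucky n cs"
    and "None \<notin> set (park n cs) \<Longrightarrow> s \<le> first_unlucky n cs \<Longrightarrow>
      park (Suc n) (map (shift s) cs) = map (map_option (shift s)) (park n cs)"
    using park_from_shift[OF assms(1) _ assms(2), of "{}"] by (auto simp: park_def)
qed

lemma park_spots_eq_all:
  assumes "as \<in> frustrated_pfs n"
  shows "{p. Some p \<in> set (park n as)} = {1..n}"
proof (rule card_subset_eq)
  show "{p. Some p \<in> set (park n as)} \<subseteq> {1..n}"
    using assms park_from_spot_in_range[of as n _ "{}"]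
    by (auto simp: frustrated_pfs_def frustrated_parking_function_def park_def)
  show "card {p. Some p \<in> set (park n as)} = card {1..n}"
    using assms card_park_spots[of n as]
    by (simp add: frustrated_pfs_def frustrated_parking_function_def)
qed simp

lemma park_snoc:
  "park n (bs @ [a]) = park n bs @ [parking_spot n {p. Some p \<in> set (park n bs)} a]"
  by (simp add: park_def park_from_append)

lemma parking_spot_last_free:
  assumes "s \<in> {1..n}" "a \<in> {1..n}"
  shows "parking_spot n ({1..n} - {s}) a = (if a \<le> s then Some s else None)"
proof -
  have "{x \<in> {1..n}. a < x \<and> x \<notin> {1..n} - {s}} = (if a < s then {s} else {})"
    using assms by auto
  then show ?thesis
    using assms unfolding parking_spot_def by (cases a s rule: linorder_cases) auto
qed

text \<open>The old cars fill every spot except \<open>s\<close>, which leaves \<open>s\<close> for any preference up to \<open>s\<close>.\<close>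

lemma park_attach:
  assumes "cs \<in> frustrated_pfs n" "1 \<le> a" "a \<le> s" "s \<le> first_unlucky n cs"
  shows "park (Suc n) (attach (cs, s, a)) = map (map_option (shift s)) (park n cs) @ [Some s]"
proof -
  have s: "s \<in> {1..Suc n}"
    using first_unlucky_range[OF assms(1)] assms(2-4) by simp
  have cs: "set cs \<subseteq> {1..n}" "None \<notin> set (park n cs)"
    using assms(1) by (auto simp: frustrated_pfs_def frustrated_parking_function_def)
  have "{p. Some p \<in> set (map (map_option (shift s)) (park n cs))}
      = shift s ` {p. Some p \<in> set (park n cs)}"
    by (auto simp: image_iff eq_commute[of "Some _" "map_option _ _"])
  also have "\<dots> = {1..Suc n} - {s}"
    by (simp only: park_spots_eq_all[OF assms(1)] shift_image[OF s])
  finally have "parking_spot (Suc n)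
      {p. Some p \<in> set (map (map_option (shift s)) (park n cs))} a = Some s"
    using parking_spot_last_free[of s "Suc n" a] s assms(2,3) by simp
  then show ?thesis
    by (simp add: attach_def park_snoc park_shift(2)[OF s cs assms(4)])
qed

lemma attach_in_frustrated_pfs:
  assumes "cs \<in> frustrated_pfs n" "1 \<le> a" "a \<le> s" "s \<le> first_unlucky n cs"
  shows "attach (cs, s, a) \<in> frustrated_pfs (Suc n)"
proof -
  have "s \<le> Suc n"
    using first_unlucky_range[OF assms(1)] assms(4) by simp
  moreover have "set (map (shift s) cs) \<subseteq> {1..Suc n}"
    using assms(1) shift_in_range[of _ n s]
    by (auto simp del: atLeastAtMost_iff simp: frustrated_pfs_def frustrated_parking_function_def)
  ultimately show ?thesis
    using assms park_attach[OF assms]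
    by (auto simp: frustrated_pfs_def frustrated_parking_function_def attach_def)
qed

text \<open>The first \<open>n\<close> cars leave exactly one spot \<open>s\<close> free. None of them prefers it, so they come
  from a street without \<open>s\<close>, and \<open>park_shift\<close> applies.\<close>

lemma attach_surj:
  assumes "as \<in> frustrated_pfs (Suc n)"
  obtains cs s a where "cs \<in> frustrated_pfs n" "1 \<le> a" "a \<le> s" "s \<le> first_unlucky n cs"
    "as = attach (cs, s, a)"
proof -
  have as: "length as = Suc n" "set as \<subseteq> {1..Suc n}" "None \<notin> set (park (Suc n) as)"
    using assms by (auto simp: frustrated_pfs_def frustrated_parking_function_def)
  then obtain bs a where snoc: "as = bs @ [a]"
    by (metis length_greater_0_conv rev_exhaust zero_less_Suc list.size(3))
  define occ where "occ = {p. Some p \<in> set (park (Suc n) bs)}"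
  have bs: "length bs = n" "set bs \<subseteq> {1..Suc n}" "None \<notin> set (park (Suc n) bs)"
    and a: "a \<in> {1..Suc n}" "None \<noteq> parking_spot (Suc n) occ a"
    using as by (auto simp: snoc park_snoc occ_def simp del: not_None_eq)
  have occ_sub: "occ \<subseteq> {1..Suc n}"
    using bs(2) park_from_spot_in_range[of bs "Suc n" _ "{}"] by (auto simp: occ_def park_def)
  have "card occ = n"
    using card_park_spots[OF bs(3)] bs(1) by (simp add: occ_def)
  then have "card ({1..Suc n} - occ) = 1"
    using occ_sub finite_subset[OF occ_sub] by (simp add: card_Diff_subset)
  then obtain s where "{1..Suc n} - occ = {s}"
    by (auto simp: card_1_singleton_iff)
  then have s: "s \<in> {1..Suc n}" and occ: "occ = {1..Suc n} - {s}"
    using occ_sub by auto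
  have "set bs \<subseteq> occ"
    using preference_gets_occupied[of _ bs "{}" "Suc n"] by (auto simp: occ_def park_def)
  then have "set bs \<subseteq> shift s ` {1..n}"
    by (simp only: occ shift_image[OF s])
  then have "bs \<in> lists (shift s ` {1..n})" by auto
  then obtain cs where cs: "bs = map (shift s) cs" "set cs \<subseteq> {1..n}"
    by (auto simp: lists_image)
  have "Some s \<notin> set (park (Suc n) bs)"
    using occ by (auto simp: occ_def)
  then have ok: "None \<notin> set (park n cs)" "s \<le> first_unlucky n cs"
    using park_shift(1)[OF s cs(2)] bs(3) by (auto simp: cs(1))
  show thesis
  proof (rule that)
    show "cs \<in> frustrated_pfs n"
      using cs ok bs(1) by (auto simp: frustrated_pfs_def frustrated_parking_function_def)
    show "a \<le> s"
      using a parking_spot_last_free[OF s a(1)] by (auto simp: occ split: if_splits)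
    show "as = attach (cs, s, a)"
      by (simp add: attach_def snoc cs(1))
  qed (use a ok in auto)
qed

lemma attach_eqD:
  assumes "cs \<in> frustrated_pfs n" "1 \<le> a" "a \<le> s" "s \<le> first_unlucky n cs"
    and "cs' \<in> frustrated_pfs n" "1 \<le> a'" "a' \<le> s'" "s' \<le> first_unlucky n cs'"
    and eq: "attach (cs, s, a) = attach (cs', s', a')"
  shows "cs = cs' \<and> s = s' \<and> a = a'"
proof -
  \<comment> \<open>The inserted spot can be read off the run: it is where the last car parks.\<close>
  have "s = s'"
    using park_attach[OF assms(1-4)] park_attach[OF assms(5-8)] eq by simp
  moreover have "inj (shift s)"
    by (simp add: inj_def)
  ultimately show ?thesis
    using eq by (auto simp: attach_def)
qed

text \<open>All old unlucky spots are at least \<open>s\<close>, so the renumbering moves each of them up by one.\<close>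

lemma unlucky_spots_attach:
  assumes "cs \<in> frustrated_pfs n" "1 \<le> a" "a \<le> s" "s \<le> first_unlucky n cs"
  shows "unlucky_spots (Suc n) (attach (cs, s, a)) =
    Suc ` unlucky_spots n cs \<union> (if a = s then {} else {s})"
proof -
  have in_image: "(x, Some p) \<in> map_prod (shift s) (map_option (shift s)) ` Z \<longleftrightarrow>
      (\<exists>y q. (y, Some q) \<in> Z \<and> x = shift s y \<and> p = shift s q)" for x p Z
    by (force simp: map_option_case split: option.splits)
  have "length cs = length (park n cs)" by simp
  then have "zip (attach (cs, s, a)) (park (Suc n) (attach (cs, s, a)))
      = map (map_prod (shift s) (map_option (shift s))) (zip cs (park n cs)) @ [(a, Some s)]"
    unfolding park_attach[OF assms] by (simp add: attach_def zip_map_map map_prod_def)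
  then have mem: "(x, Some p) \<in> set (zip (attach (cs, s, a)) (park (Suc n) (attach (cs, s, a)))) \<longleftrightarrow>
      x = a \<and> p = s \<or>
      (\<exists>y q. (y, Some q) \<in> set (zip cs (park n cs)) \<and> x = shift s y \<and> p = shift s q)" for x p
    using in_image[of x p "set (zip cs (park n cs))"] by auto
  have "p \<in> unlucky_spots (Suc n) (attach (cs, s, a)) \<longleftrightarrow>
      (\<exists>q \<in> unlucky_spots n cs. p = shift s q) \<or> p = s \<and> a \<noteq> s" for p
    unfolding unlucky_spots_def mem mem_Collect_eq bex_simps by (metis shift_eq_iff)
  then have "unlucky_spots (Suc n) (attach (cs, s, a))
      = shift s ` unlucky_spots n cs \<union> (if a = s then {} else {s})"
    by (auto simp: image_iff)
  moreover have "shift s ` unlucky_spots n cs = Suc ` unlucky_spots n cs"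
    using assms(4) by (intro image_cong refl) (auto simp: first_unlucky_def shift_def)
  ultimately show ?thesis by simp
qed

lemma first_unlucky_attach:
  assumes "cs \<in> frustrated_pfs n" "1 \<le> a" "a \<le> s" "s \<le> first_unlucky n cs"
  shows "first_unlucky (Suc n) (attach (cs, s, a)) =
    (if a = s then Suc (first_unlucky n cs) else s)"
proof -
  let ?U = "insert (Suc n) (unlucky_spots n cs)"
  have Suc: "Min (Suc ` ?U) = Suc (first_unlucky n cs)"
    unfolding first_unlucky_def by (rule mono_Min_commute[symmetric]) (auto simp: mono_def)
  show ?thesis
  proof (cases "a = s")
    case True
    then show ?thesis
      using Suc unlucky_spots_attach[OF assms] by (simp add: first_unlucky_def)
  next
    case False
    then have "insert (Suc (Suc n)) (unlucky_spots (Suc n) (attach (cs, s, a)))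
        = insert s (Suc ` ?U)"
      using unlucky_spots_attach[OF assms] by auto
    then show ?thesis
      using False Suc assms(4) by (simp add: first_unlucky_def[of "Suc n"])
  qed
qed

lemma card_lucky_cars_attach:
  assumes "cs \<in> frustrated_pfs n" "1 \<le> a" "a \<le> s" "s \<le> first_unlucky n cs"
  shows "card (lucky_cars (Suc n) (attach (cs, s, a))) =
    card (lucky_cars n cs) + (if a = s then 1 else 0)"
proof -
  have len: "length cs = n" and "None \<notin> set (park n cs)"
    using assms(1) by (auto simp: frustrated_pfs_def frustrated_parking_function_def)
  have "j \<in> lucky_cars (Suc n) (attach (cs, s, a)) \<longleftrightarrow>
      j \<in> lucky_cars n cs \<or> j = Suc n \<and> a = s" for j
  proof (cases "j \<in> {1..n}")
    case True
    then show ?thesis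
      using len unfolding lucky_cars_def park_attach[OF assms]
      by (cases "park n cs ! (j - 1)") (auto simp: attach_def nth_append)
  next
    case False
    then show ?thesis
      using len unfolding lucky_cars_def park_attach[OF assms]
      by (auto simp: attach_def nth_append)
  qed
  then have "lucky_cars (Suc n) (attach (cs, s, a)) =
      lucky_cars n cs \<union> (if a = s then {Suc n} else {})"
    by auto
  moreover have "Suc n \<notin> lucky_cars n cs" "finite (lucky_cars n cs)"
    by (auto simp: lucky_cars_def)
  ultimately show ?thesis by simp
qed


section \<open>Counting by lucky cars and first unlucky spot\<close>

text \<open>The number \<open>k\<close> of lucky cars ranges over the integers, so that the recurrences with
  \<open>k - 1\<close> hold without exceptions at \<open>k = 0\<close>.\<close>

definition count_first :: "nat \<Rightarrow> nat \<Rightarrow> int \<Rightarrow> int" where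
  "count_first n u k = int (card {as \<in> frustrated_pfs n.
     first_unlucky n as = u \<and> int (card (lucky_cars n as)) = k})"

definition count_from :: "nat \<Rightarrow> nat \<Rightarrow> int \<Rightarrow> int" where
  "count_from n u k = int (card {as \<in> frustrated_pfs n.
     u \<le> first_unlucky n as \<and> int (card (lucky_cars n as)) = k})"

lemma count_from_eq_first_plus: "count_from n u k = count_first n u k + count_from n (Suc u) k"
proof -
  let ?K = "\<lambda>as. int (card (lucky_cars n as)) = k"
  have "{as \<in> frustrated_pfs n. u \<le> first_unlucky n as \<and> ?K as} =
    {as \<in> frustrated_pfs n. first_unlucky n as = u \<and> ?K as} \<union>
    {as \<in> frustrated_pfs n. Suc u \<le> first_unlucky n as \<and> ?K as}"
    by auto
  then show ?thesis
    unfolding count_first_def count_from_def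
    by (simp add: card_Un_disjoint[symmetric] disjoint_iff del: of_nat_add flip: of_nat_add)
qed

lemma count_zero_beyond:
  assumes "u > Suc n"
  shows "count_first n u k = 0" "count_from n u k = 0"
  using assms first_unlucky_range[of _ n] by (force simp: count_first_def count_from_def)+

lemma count_first_empty: "count_first 0 (Suc 0) k = (if k = 0 then 1 else 0)"
proof -
  have "frustrated_pfs 0 = {[]}" "first_unlucky 0 [] = Suc 0" "lucky_cars 0 [] = {}"
    by (auto simp: frustrated_pfs_def frustrated_parking_function_def park_def
        first_unlucky_def unlucky_spots_def lucky_cars_def)
  then have "{as \<in> frustrated_pfs 0. first_unlucky 0 as = Suc 0 \<and>
      int (card (lucky_cars 0 as)) = k} = (if k = 0 then {[]} else {})"
    by auto
  then show ?thesis by (simp add: count_first_def)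
qed

text \<open>There are two ways to reach the smallest unlucky spot \<open>u + 1\<close>. Either it was \<open>u\<close> and a lucky
  car came in at one of the spots \<open>1, \<dots>, u\<close>, or an unlucky car came in at spot \<open>u + 1\<close> itself,
  with one of the preferences \<open>1, \<dots>, u\<close>.\<close>

lemma count_first_Suc:
  "count_first (Suc n) (Suc u) k = int u * (count_first n u (k - 1) + count_from n (Suc u) k)"
proof -
  let ?L = "\<lambda>n as. int (card (lucky_cars n as))"
  define A where "A = {cs \<in> frustrated_pfs n. first_unlucky n cs = u \<and> ?L n cs = k - 1}"
  define B where "B = {cs \<in> frustrated_pfs n. Suc u \<le> first_unlucky n cs \<and> ?L n cs = k}"
  define X where "X = A \<times> (\<lambda>s. (s, s)) ` {1..u}"
  define Y where "Y = B \<times> {Suc u} \<times> {1..u}"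
  have XY: "cs \<in> frustrated_pfs n \<and> 1 \<le> a \<and> a \<le> s \<and> s \<le> first_unlucky n cs"
    if "(cs, s, a) \<in> X \<union> Y" for cs s a
    using that by (auto simp: X_def Y_def A_def B_def)
  have "{as \<in> frustrated_pfs (Suc n). first_unlucky (Suc n) as = Suc u \<and> ?L (Suc n) as = k}
      = attach ` (X \<union> Y)" (is "?C = _")
  proof (intro equalityI subsetI)
    fix as assume as: "as \<in> ?C"
    then obtain cs s a where
      csa: "cs \<in> frustrated_pfs n" "1 \<le> a" "a \<le> s" "s \<le> first_unlucky n cs"
      and eq: "as = attach (cs, s, a)"
      by (blast elim: attach_surj)
    have "(cs, s, a) \<in> X \<union> Y"
      using as csa first_unlucky_attach[OF csa] card_lucky_cars_attach[OF csa]
      by (auto simp: eq X_def Y_def A_def B_def split: if_splits)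
    then show "as \<in> attach ` (X \<union> Y)"
      using eq by blast
  next
    fix as assume "as \<in> attach ` (X \<union> Y)"
    then obtain cs s a where mem: "(cs, s, a) \<in> X \<union> Y" and eq: "as = attach (cs, s, a)"
      by auto
    then have csa: "cs \<in> frustrated_pfs n" "1 \<le> a" "a \<le> s" "s \<le> first_unlucky n cs"
      using XY by blast+
    show "as \<in> ?C"
      using mem attach_in_frustrated_pfs[OF csa] first_unlucky_attach[OF csa]
        card_lucky_cars_attach[OF csa]
      by (auto simp: eq X_def Y_def A_def B_def)
  qed
  moreover have "inj_on attach (X \<union> Y)"
  proof (rule inj_onI)
    fix x y assume xy: "x \<in> X \<union> Y" "y \<in> X \<union> Y" "attach x = attach y"
    obtain cs s a cs' s' a' where "x = (cs, s, a)" "y = (cs', s', a')"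
      using prod_cases3 by metis
    then show "x = y"
      using attach_eqD[of cs n a s cs' a' s'] XY[of cs s a] XY[of cs' s' a'] xy by blast
  qed
  ultimately have "card ?C = card (X \<union> Y)"
    by (simp add: card_image)
  moreover have "finite A" "finite B"
    by (auto simp: A_def B_def)
  then have "card (X \<union> Y) = card A * u + card B * u"
    by (subst card_Un_disjoint)
      (auto simp: X_def Y_def card_cartesian_product card_image inj_on_def)
  ultimately show ?thesis
    by (simp add: count_first_def count_from_def A_def B_def algebra_simps)
qed

section \<open>The Eulerian recurrence\<close>

text \<open>The difference of two neighbouring instances of the claim is exactly the assumed relation,
  so downward induction on \<open>u\<close> works, starting where all counts vanish.\<close>

lemma count_from_Suc:
  assumes balance: "\<And>v k. int v * count_from n (Suc v) k =
      k * count_first n (Suc v) k + (2 * int n + 1 - k - int v) * count_first n (Suc v) (k - 1)"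
    and "u \<ge> 1"
  shows "count_from (Suc n) (Suc u) k = k * count_from n (Suc u) k +
    int u * count_from n u (k - 1) + (2 * int n + 2 - k - int u) * count_from n (Suc u) (k - 1)"
proof (cases "u \<ge> Suc (Suc n)")
  case True
  then show ?thesis by (simp add: count_zero_beyond)
next
  case False
  then have "u \<le> Suc (Suc n)" by simp
  then show ?thesis
  proof (induction u rule: inc_induct)
    case base
    then show ?case by (simp add: count_zero_beyond)
  next
    case (step u)
    have "count_from (Suc n) (Suc u) k
        = int u * (count_first n u (k - 1) + count_from n (Suc u) k)
          + count_from (Suc n) (Suc (Suc u)) k"
      using count_from_eq_first_plus[of "Suc n" "Suc u" k] by (simp add: count_first_Suc)
    then show ?case
      using step.IH balance[of u k] count_from_eq_first_plus[of n u "k - 1"]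
        count_from_eq_first_plus[of n "Suc u" "k - 1"] count_from_eq_first_plus[of n "Suc u" k]
      by (simp add: algebra_simps)
  qed
qed

text \<open>Both counts with index \<open>Suc n\<close> on the right carry the factor \<open>v\<close> by \<open>count_first_Suc\<close>. After
  cancelling it, the claim expresses \<open>count_from (Suc n) (Suc v) k\<close> by counts with index \<open>n\<close>. So
  does \<open>count_from_Suc\<close>, and the two expressions agree by the induction hypothesis for the
  neighbouring arguments \<open>v - 1\<close> and \<open>k - 1\<close>.\<close>

lemma count_balance:
  "int v * count_from n (Suc v) k =
    k * count_first n (Suc v) k + (2 * int n + 1 - k - int v) * count_first n (Suc v) (k - 1)"
proof (induction n arbitrary: v k)
  case 0
  show ?case
  proof (cases v)
    case 0
    then show ?thesis by (simp add: count_first_empty)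
  next
    case (Suc v)
    then show ?thesis by (simp add: count_zero_beyond)
  qed
next
  case (Suc n)
  show ?case
  proof (cases v)
    case 0
    then show ?thesis by (simp add: count_first_Suc)
  next
    case v: (Suc w)
    have "count_from (Suc n) (Suc v) k = k * count_from n (Suc v) k +
        int v * count_from n v (k - 1) + (2 * int n + 2 - k - int v) * count_from n (Suc v) (k - 1)"
      using v by (intro count_from_Suc Suc.IH) simp
    also have "int v * count_from n v (k - 1) = count_from n v (k - 1) +
        (k - 1) * count_first n v (k - 1) + (2 * int n + 3 - k - int v) * count_first n v (k - 2)"
      using Suc.IH[of w "k - 1"] v by (simp add: algebra_simps)
    finally have "count_from (Suc n) (Suc v) k =
        k * (count_first n v (k - 1) + count_from n (Suc v) k) +
        (2 * int n + 3 - k - int v) * (count_first n v (k - 2) + count_from n (Suc v) (k - 1))"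
      using count_from_eq_first_plus[of n v "k - 1"] by (simp add: algebra_simps)
    then show ?thesis
      by (simp only: count_first_Suc) (simp add: algebra_simps)
  qed
qed

lemma count_from_1:
  "count_from n 1 k = int (card {as \<in> frustrated_pfs n. int (card (lucky_cars n as)) = k})"
  unfolding count_from_def using first_unlucky_range[of _ n]
  by (intro arg_cong[where f = "\<lambda>A. int (card A)"]) auto

text \<open>The car in spot \<open>1\<close> is lucky, because an unlucky car parks above its preference.\<close>

lemma count_from_2: "count_from (Suc n) (Suc 1) k = count_from (Suc n) 1 k"
  using count_from_eq_first_plus[of "Suc n" 1 k] count_first_Suc[of n 0 k] by simp

lemma eulerian2_eq_0: "k < 1 \<or> k > n \<Longrightarrow> eulerian2 n k = 0"
  by (subst eulerian2.simps) simp

lemma count_from_eq_eulerian2: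
  "count_from (Suc n) 1 k = int (eulerian2 (Suc n) (nat k))"
proof (induction n arbitrary: k)
  case 0
  have "count_from (Suc 0) 1 k = count_first (Suc 0) (Suc 1) k + count_from (Suc 0) (Suc (Suc 1)) k"
    using count_from_2[of 0 k] count_from_eq_first_plus[of "Suc 0" "Suc 1" k] by simp
  also have "\<dots> = (if k = 1 then 1 else 0)"
    by (simp add: count_first_Suc count_zero_beyond count_first_empty)
  also have "\<dots> = int (eulerian2 (Suc 0) (nat k))"
    by (subst eulerian2.simps) auto
  finally show ?case .
next
  case (Suc n)
  have "count_from (Suc (Suc n)) (Suc 1) k = k * count_from (Suc n) (Suc 1) k +
      int 1 * count_from (Suc n) 1 (k - 1) +
      (2 * int (Suc n) + 2 - k - int 1) * count_from (Suc n) (Suc 1) (k - 1)"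
    by (intro count_from_Suc count_balance) simp
  then have rec: "count_from (Suc (Suc n)) 1 k =
      k * int (eulerian2 (Suc n) (nat k)) +
      (2 * int (Suc (Suc n)) - k) * int (eulerian2 (Suc n) (nat (k - 1)))"
    unfolding count_from_2 Suc.IH by (simp add: algebra_simps)
  consider "k \<le> 0" | "k > int (Suc (Suc n))" | "1 \<le> k" "k \<le> int (Suc (Suc n))"
    by linarith
  then show ?case
  proof cases
    case 1
    then show ?thesis unfolding rec by (simp add: eulerian2_eq_0)
  next
    case 2
    then show ?thesis unfolding rec by (simp add: eulerian2_eq_0)
  next
    case 3
    define j where "j = nat k"
    have k: "k = int j" and j: "1 \<le> j" "j \<le> Suc (Suc n)"
      using 3 by (auto simp: j_def)
    have "eulerian2 (Suc (Suc n)) j =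
        j * eulerian2 (Suc n) j + (2 * Suc (Suc n) - j) * eulerian2 (Suc n) (j - 1)"
      using j by (subst eulerian2.simps) simp
    moreover have "nat (int j - 1) = j - 1" "int (2 * Suc (Suc n) - j) = 2 * int (Suc (Suc n)) - int j"
      using j by auto
    ultimately show ?thesis
      using rec unfolding k by (simp only: nat_int of_nat_add of_nat_mult)
  qed
qed

section \<open>Lucky spots\<close>

text \<open>A lucky car's spot is its preference, and different cars park in different spots.\<close>

lemma card_lucky_spots:
  assumes "frustrated_parking_function n as"
  shows "card (lucky_spots n as) = card (lucky_cars n as)"
proof -
  have "length as = n" "distinct (park n as)"
    using assms distinct_park_from[of n "{}" as]
    by (auto simp: frustrated_parking_function_def park_def)
  have "inj_on (\<lambda>j. as ! (j - 1)) (lucky_cars n as)"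
  proof (rule inj_onI)
    fix i j assume ij: "i \<in> lucky_cars n as" "j \<in> lucky_cars n as" "as ! (i - 1) = as ! (j - 1)"
    then have "park n as ! (i - 1) = park n as ! (j - 1)" "i - 1 < n" "j - 1 < n" "1 \<le> i" "1 \<le> j"
      by (auto simp: lucky_cars_def)
    then show "i = j"
      using \<open>length as = n\<close> \<open>distinct (park n as)\<close> nth_eq_iff_index_eq[of "park n as" "i - 1" "j - 1"]
      by simp
  qed
  moreover have "as ! (j - 1) \<in> {1..n}" if "j \<in> lucky_cars n as" for j
  proof -
    have "j - 1 < length as"
      using that \<open>length as = n\<close> by (auto simp: lucky_cars_def)
    then show ?thesis
      using nth_mem assms by (fastforce simp: frustrated_parking_function_def)
  qed
  then have "lucky_spots n as = (\<lambda>j. as ! (j - 1)) ` lucky_cars n as"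
    unfolding lucky_spots_def by (auto simp: lucky_cars_def)
  ultimately show ?thesis
    by (simp add: card_image)
qed

theorem corollary2p19:
  fixes n k :: nat
  assumes "1 \<le> k" and "k \<le> n"
  shows "card {as. frustrated_parking_function n as \<and> card (lucky_cars n as) = k} = eulerian2 n k
    \<and> card {as. frustrated_parking_function n as \<and> card (lucky_spots n as) = k} = eulerian2 n k"
proof -
  obtain m where n: "n = Suc m" using assms by (cases n) auto
  have cars: "card {as. frustrated_parking_function n as \<and> card (lucky_cars n as) = k} = eulerian2 n k"
    using count_from_eq_eulerian2[of m "int k"] unfolding count_from_1
    by (simp add: frustrated_pfs_def n)
  have "{as. frustrated_parking_function n as \<and> card (lucky_spots n as) = k}
      = {as. frustrated_parking_function n as \<and> card (lucky_cars n as) = k}"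
    using card_lucky_spots by auto
  with cars show ?thesis by simp
qed

end
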